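(* Let $(G,\theta)$ be a measured group with $G$ noncompact, and let $(X,\mu)$ be a stationary $(G,\theta)$-space. Then the action of $G$ on $(X,\mu)$ is conservative: for every Borel set $A\subseteq X$ with $\mu(A)>0$, the set $G_A:=\{g\in G:\mu(g.A\cap A)>0\}$ is not relatively compact in $G$.
   Context: A measured group $(G,\theta)$ is a locally compact second countable (lcsc) group $G$ with an admissible Borel probability measure $\theta$, i.e. $\theta$ is absolutely continuous with respect to Haar measure and is not supported on a closed proper subsemigroup of $G$ (equivalently $G=\overline{\bigcup_{n\ge1}\mathrm{supp}(\theta^{\ast n})}$, with $\theta^{\ast n}$ the $n$-fold convolution power). A Borel $G$-space is a standard Borel space $X$ with a Borel action map $G\times X\to X$, $(g,x)\mapsto g.x$. For a measure $\mu$ on $X$, $g\mu(A):=\mu(g^{-1}.A)$. A stationary $(G,\theta)$-space is a Borel $G$-space $X$ with a Borel probability measure $\mu$ such that $\theta\ast\mu=\mu$, where $\theta\ast\mu(A)=\int_G g\mu(A)\,d\theta(g)$. (Such a $\mu$ is automatically quasi-invariant, i.e. $g\mu\sim\mu$ for all $g\in G$.) *)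

theory Defs
  imports "HOL-Probability.Probability"
begin

text \<open>
  Groups are written additively because the library's class of topological groups,
  \<^class>\<open>topological_group_add\<close>, is additive. It extends \<^class>\<open>group_add\<close>, so
  commutativity is not assumed: \<open>g + h\<close>, \<open>- g\<close>, \<open>0\<close> stand for the product, the inverse
  and the identity.
\<close>

class lcsc_group = topological_group_add + t2_space + second_countable_topology +
  assumes locally_compact: "\<exists>U K. open U \<and> compact K \<and> x \<in> U \<and> U \<subseteq> K"

text \<open>
  Left Haar measures. On a second countable locally compact Hausdorff space every Borel
  measure that is finite on compact sets is regular, so regularity need not be required.
\<close>

definition haar_measure :: "'g::lcsc_group measure \<Rightarrow> bool" where
  "haar_measure H \<longleftrightarrow>
     sets H = sets borel \<and>
     emeasure H UNIV \<noteq> 0 \<and>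
     (\<forall>K. compact K \<longrightarrow> emeasure H K < \<infinity>) \<and>
     (\<forall>g. \<forall>A\<in>sets borel. emeasure H ((\<lambda>h. g + h) ` A) = emeasure H A)"

text \<open>
  As Haar measures are unique up to scaling, it does not matter which one the existential
  quantifier in \<open>absolutely_continuous_haar\<close> picks.
\<close>

locale measured_group = prob_space \<theta> for \<theta> :: "'g::lcsc_group measure" +
  assumes sets_eq_borel: "sets \<theta> = sets borel"
    and absolutely_continuous_haar: "\<exists>H. haar_measure H \<and> absolutely_continuous H \<theta>"
    and not_supported_on_subsemigroup:
      "\<And>S. closed S \<Longrightarrow> (\<forall>g\<in>S. \<forall>h\<in>S. g + h \<in> S) \<Longrightarrow> emeasure \<theta> S = 1 \<Longrightarrow> S = UNIV"

text \<open>Only the underlying measurable space of \<open>M\<close> matters here, not its measure.\<close>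

definition standard_borel :: "'x measure \<Rightarrow> bool" where
  "standard_borel M \<longleftrightarrow>
     (\<exists>T. topspace T = space M \<and> completely_metrizable_space T \<and> second_countable T \<and>
          sets M = sigma_sets (space M) {U. openin T U})"

locale borel_G_space =
  fixes act :: "'g::lcsc_group \<Rightarrow> 'x \<Rightarrow> 'x" and M :: "'x measure"
  assumes standard_borel: "standard_borel M"
    and measurable_act: "(\<lambda>(g, x). act g x) \<in> borel \<Otimes>\<^sub>M M \<rightarrow>\<^sub>M M"
    and act_zero: "\<And>x. x \<in> space M \<Longrightarrow> act 0 x = x"
    and act_add: "\<And>g h x. x \<in> space M \<Longrightarrow> act (g + h) x = act g (act h x)"

definition translate :: "('g::lcsc_group \<Rightarrow> 'x \<Rightarrow> 'x) \<Rightarrow> 'g \<Rightarrow> 'x measure \<Rightarrow> 'x set \<Rightarrow> ennreal" where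
  "translate act g \<mu> A = emeasure \<mu> (act (- g) ` A)"

definition action_convolution ::
    "('g::lcsc_group \<Rightarrow> 'x \<Rightarrow> 'x) \<Rightarrow> 'g measure \<Rightarrow> 'x measure \<Rightarrow> 'x set \<Rightarrow> ennreal" where
  "action_convolution act \<theta> \<mu> A = (\<integral>\<^sup>+ g. translate act g \<mu> A \<partial>\<theta>)"

locale stationary_space = borel_G_space act \<mu> + prob_space \<mu>
  for \<theta> :: "'g::lcsc_group measure" and act :: "'g \<Rightarrow> 'x \<Rightarrow> 'x" and \<mu> :: "'x measure" +
  assumes stationary: "\<And>A. A \<in> sets \<mu> \<Longrightarrow> action_convolution act \<theta> \<mu> A = emeasure \<mu> A"

definition return_set :: "('g::lcsc_group \<Rightarrow> 'x \<Rightarrow> 'x) \<Rightarrow> 'x measure \<Rightarrow> 'x set \<Rightarrow> 'g set" where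
  "return_set act \<mu> A = {g. emeasure \<mu> (act g ` A \<inter> A) > 0}"

definition conservative :: "('g::lcsc_group \<Rightarrow> 'x \<Rightarrow> 'x) \<Rightarrow> 'x measure \<Rightarrow> bool" where
  "conservative act \<mu> \<longleftrightarrow>
     (\<forall>A\<in>sets \<mu>. emeasure \<mu> A > 0 \<longrightarrow> \<not> compact (closure (return_set act \<mu> A)))"

end

theory Submission
  imports Defs
begin

text \<open>
  For Borel \<open>A\<close> put \<open>F g = \<mu> {x. act g x \<in> A}\<close>. Stationarity says that \<open>F\<close> is harmonic:
  \<open>F g = (\<integral>h. F (g + h) \<partial>\<theta>)\<close>. Absolute continuity of \<open>\<theta>\<close> and admissibility make \<open>\<mu>\<close>
  quasi-invariant. If the return set of \<open>A\<close> were relatively compact, then group elements far apart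
  would have almost disjoint preimages of \<open>A\<close>, so \<open>F\<close> would vanish at infinity. But a nonnegative
  nonzero bounded harmonic function that vanishes at infinity forces \<open>G\<close> to be compact: from points
  where \<open>F\<close> is close to its supremum, the support of the random walk only leads to points where
  \<open>F\<close> is still close to its supremum, so the closed semigroup generated by the support of
  \<open>\<theta>\<close>, which is all of \<open>G\<close>, lies in a compact set.
\<close>

section \<open>Regularity of topological groups and of finite Borel measures on them\<close>

lemma topological_group_add_regular:
  fixes x :: "'g::topological_group_add"
  assumes "open U" "x \<in> U"
  obtains V where "open V" "x \<in> V" "closure V \<subseteq> U"
proof -
  \<comment> \<open>Continuity of subtraction at \<open>(x, 0)\<close> gives \<open>V\<close> and
    \<open>W\<close> with \<open>V - W\<close> inside \<open>U\<close>. If \<open>y\<close> is in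
    the closure of \<open>V\<close>, its neighbourhood \<open>y + W\<close> meets \<open>V\<close>
    in some \<open>z = y + w\<close>, and then \<open>y = z - w\<close> lies in
    \<open>U\<close>.\<close>
  have "open ((\<lambda>(v, w). v - w :: 'g) -` U)"
    by (intro open_vimage assms) (auto simp: split_beta intro!: continuous_intros)
  moreover have "(x, 0) \<in> (\<lambda>(v, w). v - w) -` U"
    using assms by simp
  ultimately obtain V W where V: "open V" "x \<in> V" and W: "open W" "0 \<in> W"
    and VW: "V \<times> W \<subseteq> (\<lambda>(v, w). v - w) -` U"
    by (auto elim!: open_prod_elim)
  have "closure V \<subseteq> U"
  proof
    fix y assume y: "y \<in> closure V"
    let ?T = "(\<lambda>z. - y + z) -` W"
    have "open ?T"
      by (intro open_vimage W) (intro continuous_on_add continuous_on_const continuous_on_id)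
    moreover have "y \<in> ?T \<inter> closure V"
      using y W(2) by simp
    ultimately have "?T \<inter> V \<noteq> {}"
      using open_Int_closure_eq_empty by blast
    then obtain z where "z \<in> V" "- y + z \<in> W"
      by blast
    then have "(z, - y + z) \<in> (\<lambda>(v, w). v - w) -` U"
      using VW by blast
    then have "z - (- y + z) \<in> U"
      by simp
    moreover have "z - (- y + z) = y"
      by (simp add: diff_eq_eq)
    ultimately show "y \<in> U" by simp
  qed
  with V show thesis using that by blast
qed

text \<open>By regularity, the basic open sets whose closures stay inside \<open>U\<close> cover
  \<open>U\<close>, and there are only countably many of them. The empty set is added to
  \<open>D\<close> so that it can be enumerated even if no basic set qualifies.\<close>

lemma open_eq_countable_Union_closed:
  fixes U :: "'g::{topological_group_add, second_countable_topology} set"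
  assumes "open U"
  shows "\<exists>C :: nat \<Rightarrow> 'g set. (\<forall>n. closed (C n)) \<and> (\<Union>n. C n) = U"
proof -
  obtain B :: "'g set set" where B: "countable B" "topological_basis B"
    using ex_countable_basis by blast
  define D where "D = insert {} (closure ` {b\<in>B. closure b \<subseteq> U})"
  have D: "countable D" "D \<noteq> {}"
    using B(1) by (auto simp: D_def)
  have "\<exists>b\<in>B. closure b \<subseteq> U \<and> x \<in> b" if "x \<in> U" for x
  proof -
    obtain V where V: "open V" "x \<in> V" "closure V \<subseteq> U"
      by (rule topological_group_add_regular[OF assms \<open>x \<in> U\<close>])
    then obtain b where "b \<in> B" "x \<in> b" "b \<subseteq> V"
      using topological_basisE[OF B(2)] by metis
    then show ?thesis using V closure_mono[of b V] by blast
  qed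
  then have "U \<subseteq> \<Union>D"
    using closure_subset by (fastforce simp: D_def)
  moreover have "\<Union>D \<subseteq> U"
    by (auto simp: D_def)
  moreover have "range (from_nat_into D) = D"
    using D by (simp add: range_from_nat_into)
  ultimately have "(\<Union>n. from_nat_into D n) = U"
    by auto
  moreover have "closed (from_nat_into D n)" for n
    using from_nat_into[OF D(2), of n] by (auto simp: D_def)
  ultimately show ?thesis
    by blast
qed

text \<open>The sets that can be squeezed between a closed and an open set with arbitrarily small
  error form a \<sigma>-algebra. It contains the open sets, since each of them is a countable union
  of closed sets and the measure is continuous from above.\<close>

lemma finite_measure_borel_regular:
  fixes M :: "'g::{topological_group_add, second_countable_topology} measure"
  assumes fin: "finite_measure M" and sets: "sets M = sets borel" and B: "B \<in> sets M" and "e > 0"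
  obtains C U where "closed C" "open U" "C \<subseteq> B" "B \<subseteq> U" "measure M (U - C) < e"
proof -
  interpret finite_measure M by fact
  have "B \<in> sigma_sets UNIV {S. open S}"
    using B unfolding sets borel_def by simp
  then have "\<forall>e>0. \<exists>C U. closed C \<and> open U \<and> C \<subseteq> B \<and> B \<subseteq> U \<and> measure M (U - C) < e"
  proof (induction rule: sigma_sets.induct)
    case (Basic U)
    then have "open U" by simp
    then obtain D :: "nat \<Rightarrow> 'g set" where D: "\<And>n. closed (D n)" "(\<Union>n. D n) = U"
      using open_eq_countable_Union_closed by metis
    have U: "U \<in> sets M" using Basic sets by auto
    define E where "E n = (\<Union>i\<le>n. D i)" for n
    have E: "closed (E n)" "E n \<subseteq> U" for n
      using D unfolding E_def by (auto intro!: closed_UN)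
    have "(\<lambda>n. measure M (U - E n)) \<longlonglongrightarrow> measure M (\<Inter>n. U - E n)"
    proof (intro finite_Lim_measure_decseq)
      show "range (\<lambda>n. U - E n) \<subseteq> sets M"
        using E(1) U sets by auto
      show "decseq (\<lambda>n. U - E n)"
        by (force simp: decseq_def E_def)
    qed
    also have "(\<Inter>n. U - E n) = {}"
      using D(2) by (auto simp: E_def)
    finally have lim: "(\<lambda>n. measure M (U - E n)) \<longlonglongrightarrow> 0" by simp
    show ?case
    proof (intro allI impI)
      fix e :: real assume "e > 0"
      then have "eventually (\<lambda>n. measure M (U - E n) < e) sequentially"
        using lim by (auto dest: order_tendstoD(2))
      then obtain n where "measure M (U - E n) < e"
        using eventually_sequentially by auto
      then show "\<exists>C V. closed C \<and> open V \<and> C \<subseteq> U \<and> U \<subseteq> V \<and> measure M (V - C) < e"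
        using E Basic by blast
    qed
  next
    case Empty
    show ?case by (auto intro!: exI[of _ "{}::'g set"])
  next
    case (Compl B)
    show ?case
    proof (intro allI impI)
      fix e :: real assume "e > 0"
      then obtain C U where CU: "closed C" "open U" "C \<subseteq> B" "B \<subseteq> U" "measure M (U - C) < e"
        using Compl.IH by metis
      have "(- C) - (- U) = U - C" by blast
      with CU show "\<exists>C U. closed C \<and> open U \<and> C \<subseteq> UNIV - B \<and> UNIV - B \<subseteq> U \<and> measure M (U - C) < e"
        by (intro exI[of _ "- U"] exI[of _ "- C"]) auto
    qed
  next
    case (Union B)
    show ?case
    proof (intro allI impI)
      fix e :: real assume e: "e > 0"
      have "\<exists>C U. closed C \<and> open U \<and> C \<subseteq> B i \<and> B i \<subseteq> U \<and> measure M (U - C) < e / 4 * (1/2)^i" for i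
        by (rule Union.IH[of i, rule_format]) (use e in simp)
      then obtain C U where CU: "\<And>i. closed (C i)" "\<And>i. open (U i)" "\<And>i. C i \<subseteq> B i" "\<And>i. B i \<subseteq> U i"
        and less: "\<And>i. measure M (U i - C i) < e / 4 * (1/2)^i"
        by metis
      have [measurable]: "C i \<in> sets M" "U i \<in> sets M" for i
        using CU sets by auto
      have s: "(\<lambda>i. e / 4 * (1/2)^i) sums (e / 4 * 2)"
        using sums_mult[OF geometric_sums[of "1/2::real"], of "e / 4"] by simp
      \<comment> \<open>An infinite union of the \<open>C i\<close> need not be closed, so only
        finitely many are kept. The errors chosen above sum to at most \<open>e / 2\<close>; this
        bounds the limit of \<open>measure M (D n)\<close> and leaves room for truncating at a
        finite \<open>n\<close>.\<close>
      define D where "D n = (\<Union>i. U i) - (\<Union>i\<le>n. C i)" for n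
      have summ: "summable (\<lambda>i. measure M (U i - C i))"
        by (rule summable_comparison_test'[OF sums_summable[OF s], of 0])
           (use less in \<open>auto intro: less_imp_le\<close>)
      have "(\<lambda>n. measure M (D n)) \<longlonglongrightarrow> measure M (\<Inter>n. D n)"
      proof (intro finite_Lim_measure_decseq)
        show "range D \<subseteq> sets M" by (auto simp: D_def)
        show "decseq D" by (force simp: decseq_def D_def)
      qed
      moreover have "measure M (\<Inter>n. D n) < e"
      proof -
        have "measure M (\<Inter>n. D n) \<le> measure M (\<Union>i. U i - C i)"
          by (intro finite_measure_mono) (auto simp: D_def)
        also have "\<dots> \<le> (\<Sum>i. measure M (U i - C i))"
          by (intro finite_measure_subadditive_countably summ) auto
        also have "\<dots> \<le> (\<Sum>i. e / 4 * (1/2)^i)"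
          by (intro suminf_le summ sums_summable[OF s]) (use less in \<open>auto intro: less_imp_le\<close>)
        also have "\<dots> < e"
          using sums_unique[OF s] e by simp
        finally show ?thesis .
      qed
      ultimately have "eventually (\<lambda>n. measure M (D n) < e) sequentially"
        by (auto dest: order_tendstoD(2))
      then obtain n where "measure M (D n) < e"
        using eventually_sequentially by auto
      moreover have "closed (\<Union>i\<le>n. C i)" "open (\<Union>i. U i)"
        using CU by (auto intro!: closed_UN)
      moreover have "(\<Union>i\<le>n. C i) \<subseteq> (\<Union>i. B i)" "(\<Union>i. B i) \<subseteq> (\<Union>i. U i)"
        using CU(3,4) by (blast, blast)
      ultimately show "\<exists>C V. closed C \<and> open V \<and> C \<subseteq> (\<Union>i. B i) \<and> (\<Union>i. B i) \<subseteq> V \<and> measure M (V - C) < e"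
        unfolding D_def by blast
    qed
  qed
  then have "\<exists>C U. closed C \<and> open U \<and> C \<subseteq> B \<and> B \<subseteq> U \<and> measure M (U - C) < e"
    using \<open>e > 0\<close> by metis
  then show thesis
    by (elim exE conjE) (rule that)
qed

section \<open>Compact exhaustion and compact subsets of positive measure\<close>

lemma lcsc_group_countable_compact_cover:
  obtains K :: "nat \<Rightarrow> 'g::lcsc_group set" where "\<And>n. compact (K n)" "(\<Union>n. K n) = UNIV"
proof -
  obtain B :: "'g set set" where B: "countable B" "topological_basis B"
    using ex_countable_basis by blast
  define D where "D = insert {} (closure ` {b\<in>B. compact (closure b)})"
  have D: "countable D" "D \<noteq> {}"
    using B(1) by (auto simp: D_def)
  have "\<exists>b\<in>B. compact (closure b) \<and> x \<in> b" for x
  proof -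
    obtain U K :: "'g set" where UK: "open U" "compact K" "x \<in> U" "U \<subseteq> K"
      using locally_compact[of x] by blast
    then obtain b where b: "b \<in> B" "x \<in> b" "b \<subseteq> U"
      using topological_basisE[OF B(2)] by metis
    then have "closure b \<subseteq> K"
      using UK(2,4) by (intro closure_minimal compact_imp_closed) auto
    then have "compact (closure b)"
      using closed_Int_compact[OF closed_closure UK(2), of b] by (simp add: inf.absorb1)
    with b show ?thesis by blast
  qed
  then have "UNIV \<subseteq> \<Union>D"
    using closure_subset by (fastforce simp: D_def)
  moreover have "range (from_nat_into D) = D"
    using D by (simp add: range_from_nat_into)
  ultimately have "(\<Union>n. from_nat_into D n) = UNIV"
    by auto
  moreover have "compact (from_nat_into D n)" for n
    using from_nat_into[OF D(2), of n] by (auto simp: D_def)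
  ultimately show thesis
    by (intro that[of "from_nat_into D"])
qed

lemma finite_measure_inner_compact:
  fixes M :: "'g::lcsc_group measure"
  assumes fin: "finite_measure M" and sets: "sets M = sets borel" and B: "B \<in> sets M" "measure M B > 0"
  obtains L where "compact L" "L \<subseteq> B" "measure M L > 0"
proof -
  interpret finite_measure M by fact
  \<comment> \<open>An error smaller than the mass of \<open>B\<close> forces \<open>C\<close> to
    have positive mass. Cutting \<open>C\<close> with a countable compact cover then leaves some
    compact piece of positive mass.\<close>
  obtain C U where CU: "closed C" "open U" "C \<subseteq> B" "B \<subseteq> U" "measure M (U - C) < measure M B"
    using finite_measure_borel_regular[OF fin sets B] by blast
  have [measurable]: "C \<in> sets M" "U \<in> sets M"
    using CU sets by auto
  have "measure M B \<le> measure M U"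
    using CU by (intro finite_measure_mono) auto
  also have "\<dots> = measure M (U - C) + measure M C"
    using CU by (subst finite_measure_Diff) auto
  finally have C: "measure M C > 0"
    using CU by simp
  obtain K :: "nat \<Rightarrow> 'g set" where K: "\<And>n. compact (K n)" "(\<Union>n. K n) = UNIV"
    using lcsc_group_countable_compact_cover by blast
  have [measurable]: "K n \<in> sets M" for n
    using compact_imp_closed[OF K(1)] sets by auto
  have "\<exists>n. measure M (C \<inter> K n) > 0"
  proof (rule ccontr)
    assume "\<not> ?thesis"
    then have "measure M (C \<inter> K n) = 0" for n
      by (metis measure_nonneg order_less_le)
    then have "C \<inter> K n \<in> null_sets M" for n
      by (auto simp: null_sets_def emeasure_eq_measure)
    then have "(\<Union>n. C \<inter> K n) \<in> null_sets M" by blast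
    moreover have "(\<Union>n. C \<inter> K n) = C" using K(2) by blast
    ultimately show False using C by (simp add: measure_eq_0_null_sets)
  qed
  then obtain n where n: "measure M (C \<inter> K n) > 0" ..
  show thesis
  proof (rule that[OF _ _ n])
    show "compact (C \<inter> K n)"
      using CU(1) K(1) by (rule closed_Int_compact)
    show "C \<inter> K n \<subseteq> B"
      using CU(3) by blast
  qed
qed

text \<open>If it failed, there would be sets \<open>E n\<close> with \<open>H\<close>-measure below
  \<open>(1/2)^n\<close> and \<open>M\<close>-measure at least \<open>e\<close>. By Borel-Cantelli
  their limsup is \<open>H\<close>-null, hence \<open>M\<close>-null, while continuity from above
  gives it \<open>M\<close>-measure at least \<open>e\<close>.\<close>

lemma (in finite_measure) absolutely_continuous_eps_delta:
  assumes ac: "absolutely_continuous H M" and sets: "sets H = sets M" and "e > 0"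
  shows "\<exists>d>0. \<forall>E\<in>sets M. emeasure H E < ennreal d \<longrightarrow> measure M E < e"
proof (rule ccontr)
  assume "\<not> ?thesis"
  then have *: "\<exists>E\<in>sets M. emeasure H E < ennreal d \<and> measure M E \<ge> e" if "d > 0" for d
    using that by (meson not_less)
  have "\<forall>n. \<exists>E. E \<in> sets M \<and> emeasure H E < ennreal ((1/2)^n) \<and> measure M E \<ge> e"
  proof
    fix n :: nat
    show "\<exists>E. E \<in> sets M \<and> emeasure H E < ennreal ((1/2)^n) \<and> measure M E \<ge> e"
      using *[of "(1/2)^n"] by auto
  qed
  then obtain E :: "nat \<Rightarrow> 'a set" where E: "\<And>n. E n \<in> sets M"
    and HE: "\<And>n. emeasure H (E n) < ennreal ((1/2)^n)" and ME: "\<And>n. measure M (E n) \<ge> e"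
    by (auto dest!: choice)
  have fin: "emeasure H (E n) < \<infinity>" for n
    using less_trans[OF HE[of n] ennreal_less_top] by simp
  have "measure H (E n) \<le> (1/2)^n" for n
    using HE[of n] by (simp add: measure_def enn2real_leI)
  then have "summable (\<lambda>n. measure H (E n))"
    by (intro summable_comparison_test'[OF summable_geometric[of "1/2::real"], of 0 "\<lambda>n. measure H (E n)"]) simp_all
  then have "limsup E \<in> null_sets H"
    by (intro borel_cantelli_limsup1 fin) (use E sets in auto)
  then have "limsup E \<in> null_sets M"
    using ac by (auto simp: absolutely_continuous_def)
  then have "measure M (limsup E) = 0"
    by (simp add: measure_eq_0_null_sets)
  moreover have "(\<lambda>n. measure M (\<Union>k\<in>{n..}. E k)) \<longlonglongrightarrow> measure M (\<Inter>n. \<Union>k\<in>{n..}. E k)"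
  proof (intro finite_Lim_measure_decseq)
    show "range (\<lambda>n. \<Union>k\<in>{n..}. E k) \<subseteq> sets M" using E by auto
    show "decseq (\<lambda>n. \<Union>k\<in>{n..}. E k)" by (intro decseq_SucI UN_mono) auto
  qed
  ultimately have "(\<lambda>n. measure M (\<Union>k\<in>{n..}. E k)) \<longlonglongrightarrow> 0"
    by (simp add: limsup_INF_SUP)
  moreover have "e \<le> measure M (\<Union>k\<in>{n..}. E k)" for n
    using E by (intro order_trans[OF ME[of n] finite_measure_mono]) auto
  ultimately have "e \<le> 0"
    by (auto intro: LIMSEQ_le_const)
  with \<open>e > 0\<close> show False by simp
qed

section \<open>Compact sets under small translations and outer approximation by Haar measure\<close>

lemma open_translates_into:
  fixes L :: "'g::topological_monoid_add set"
  assumes "compact L" "open U" "L \<subseteq> U"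
  obtains V where "open V" "0 \<in> V" "\<And>v l. v \<in> V \<Longrightarrow> l \<in> L \<Longrightarrow> v + l \<in> U"
proof -
  have "open ((\<lambda>(v, l). v + l) -` U)"
    by (intro open_vimage assms) (auto simp: split_beta intro!: continuous_intros)
  moreover have "{0} \<times> L \<subseteq> (\<lambda>(v, l). v + l) -` U"
    using assms by auto
  ultimately have "\<exists>V. 0 \<in> V \<and> open V \<and> V \<times> L \<subseteq> (\<lambda>(v, l). v + l) -` U"
    by (rule Elementary_Topology.tube_lemma[OF assms(1)])
  then obtain V where "open V" "0 \<in> V" "V \<times> L \<subseteq> (\<lambda>(v, l). v + l) -` U"
    by (elim exE conjE)
  show thesis
  proof
    show "open V" "0 \<in> V" by fact+
    show "v + l \<in> U" if "v \<in> V" "l \<in> L" for v l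
      using \<open>V \<times> L \<subseteq> _\<close> that by auto
  qed
qed

lemma lcsc_group_compact_neighbourhood:
  fixes L :: "'g::lcsc_group set"
  assumes "compact L"
  obtains W K where "open W" "compact K" "L \<subseteq> W" "W \<subseteq> K"
proof -
  have "\<forall>x::'g. \<exists>U K. open U \<and> compact K \<and> x \<in> U \<and> U \<subseteq> K"
    using locally_compact by blast
  then obtain U K :: "'g \<Rightarrow> 'g set"
    where UK: "\<And>x. open (U x) \<and> compact (K x) \<and> x \<in> U x \<and> U x \<subseteq> K x"
    by metis
  obtain F where F: "F \<subseteq> L" "finite F" "L \<subseteq> (\<Union>x\<in>F. U x)"
    using compactE_image[OF assms, of L U] UK by blast
  show thesis
  proof
    show "open (\<Union>x\<in>F. U x)" "compact (\<Union>x\<in>F. K x)"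
      using F(2) UK by (auto intro!: compact_UN)
    show "L \<subseteq> (\<Union>x\<in>F. U x)" by fact
    show "(\<Union>x\<in>F. U x) \<subseteq> (\<Union>x\<in>F. K x)"
      using UK by blast
  qed
qed

text \<open>Haar measure may be infinite, so it is first restricted to an open neighbourhood
  \<open>W\<close> of \<open>L\<close> contained in a compact set; there the regularity of finite
  measures applies.\<close>

lemma haar_measure_outer_open:
  assumes H: "haar_measure H" and L: "compact L" and "d > 0"
  obtains U where "open U" "L \<subseteq> U" "emeasure H U < \<infinity>" "emeasure H (U - L) < ennreal d"
proof -
  have sets: "sets H = sets borel" and fin: "\<And>K. compact K \<Longrightarrow> emeasure H K < \<infinity>"
    using H by (auto simp: haar_measure_def)
  obtain W K where W: "open W" "compact K" "L \<subseteq> W" "W \<subseteq> K"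
    using lcsc_group_compact_neighbourhood[OF L] by blast
  have meas: "W \<in> sets H" "L \<in> sets H" "K \<in> sets H"
    unfolding sets using W(1,2) L by (simp_all add: borel_compact)
  have W_fin: "emeasure H W < \<infinity>"
    using le_less_trans[OF emeasure_mono[OF W(4) meas(3)] fin[OF W(2)]] .
  define N where "N = density H (indicator W)"
  have N: "emeasure N B = emeasure H (W \<inter> B)" if "B \<in> sets borel" for B
    unfolding N_def by (rule emeasure_restricted[OF meas(1)]) (simp add: sets that)
  have setsN: "sets N = sets borel"
    by (simp add: N_def sets)
  have "emeasure N (space N) \<noteq> \<infinity>"
    using N[of UNIV] W_fin sets_eq_imp_space_eq[OF setsN] by simp
  then have finN: "finite_measure N" ..
  obtain C U where CU: "closed C" "open U" "C \<subseteq> L" "L \<subseteq> U" "measure N (U - C) < d"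
    by (rule finite_measure_borel_regular[OF finN setsN _ \<open>d > 0\<close>, of L])
       (use meas(2) sets setsN in auto)
  interpret N: finite_measure N by fact
  have "emeasure H (U \<inter> W - L) = emeasure N (U - L)"
    using CU(2) meas(2) sets by (subst N) (auto intro!: arg_cong[where f = "emeasure H"])
  also have "\<dots> \<le> emeasure N (U - C)"
    using CU setsN by (intro emeasure_mono) auto
  also have "\<dots> < ennreal d"
    using CU(5) \<open>d > 0\<close> by (simp add: N.emeasure_eq_measure ennreal_less_iff)
  finally have "emeasure H (U \<inter> W - L) < ennreal d" .
  moreover have "emeasure H (U \<inter> W) < \<infinity>"
    using le_less_trans[OF emeasure_mono[OF Int_lower2 meas(1)] W_fin] .
  ultimately show thesis
    using CU(2,4) W(1,3) by (intro that[of "U \<inter> W"] open_Int Int_greatest)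
qed

section \<open>Random walk on the group: admissibility and the maximum principle\<close>

context measured_group
begin

lemma translation_measurable [measurable]: "(\<lambda>h. g + h) \<in> borel_measurable \<theta>"
  unfolding measurable_cong_sets[OF sets_eq_borel refl]
  by (intro borel_measurable_continuous_onI continuous_intros)

text \<open>This is where absolute continuity enters. A compact set \<open>L\<close> of positive
  mass inside the translate of \<open>P\<close> keeps positive mass after a small translation,
  because it then overlaps itself up to a set of small Haar measure.\<close>

lemma open_translates_positive:
  assumes [measurable]: "P \<in> sets borel"
  shows "open {g. prob {h. g + h \<in> P} > 0}"
proof (subst open_subopen, rule ballI)
  fix g0 assume "g0 \<in> {g. prob {h. g + h \<in> P} > 0}"
  then have pos: "prob {h. g0 + h \<in> P} > 0" by simp
  have space: "space \<theta> = UNIV"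
    using sets_eq_imp_space_eq[OF sets_eq_borel] by simp
  have meas: "{h. g + h \<in> P} \<in> events" for g
    using measurable_sets[OF translation_measurable assms, of g] by (simp add: space vimage_def)
  obtain L where L: "compact L" "L \<subseteq> {h. g0 + h \<in> P}" "prob L > 0"
    using finite_measure_inner_compact[OF finite_measure_axioms sets_eq_borel meas pos] by blast
  obtain H where H: "haar_measure H" "absolutely_continuous H \<theta>"
    using absolutely_continuous_haar by blast
  have setsH: "sets H = sets borel"
    and inv: "\<And>g A. A \<in> sets borel \<Longrightarrow> emeasure H ((\<lambda>h. g + h) ` A) = emeasure H A"
    using H(1) by (auto simp: haar_measure_def)
  \<comment> \<open>With this \<open>d\<close>, a set of Haar measure below \<open>d\<close> cannot
    carry all the mass of \<open>L\<close>.\<close>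
  obtain d where d: "d > 0" "\<And>E. E \<in> events \<Longrightarrow> emeasure H E < ennreal d \<Longrightarrow> prob E < prob L"
    using absolutely_continuous_eps_delta[OF H(2) _ L(3)] setsH sets_eq_borel by auto
  obtain U where U: "open U" "L \<subseteq> U" "emeasure H U < \<infinity>" "emeasure H (U - L) < ennreal d"
    using haar_measure_outer_open[OF H(1) L(1) d(1)] by blast
  obtain V where V: "open V" "0 \<in> V" "\<And>v l. v \<in> V \<Longrightarrow> l \<in> L \<Longrightarrow> v + l \<in> U"
    using open_translates_into[OF L(1) U(1,2)] by blast
  have overlap: "prob ((\<lambda>l. u + l) ` L) > 0" if u: "u \<in> V" for u
  proof -
    let ?L = "(\<lambda>l. u + l) ` L"
    have cpt: "compact ?L"
      by (intro compact_continuous_image L continuous_intros)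
    have b: "L \<in> sets borel" "?L \<in> sets borel" "U \<in> sets borel"
      using L(1) cpt U(1) by (auto intro: borel_compact)
    have LU: "?L \<subseteq> U"
      using V(3)[OF u] by blast
    have finL: "emeasure H L \<noteq> \<infinity>"
      using emeasure_mono[OF U(2), of H] U(1,3) setsH by (auto simp: top_unique)
    \<comment> \<open>Both \<open>L\<close> and its translate lie in \<open>U\<close> and have equal
      Haar measure, so their complements in \<open>U\<close> are equally small.\<close>
    have "emeasure H (L - ?L) \<le> emeasure H (U - ?L)"
      using U(2) b setsH by (intro emeasure_mono) auto
    also have "\<dots> = emeasure H U - emeasure H ?L"
      using b setsH LU inv[of L u] finL by (intro emeasure_Diff) auto
    also have "\<dots> = emeasure H U - emeasure H L"
      using inv b by simp
    also have "\<dots> = emeasure H (U - L)"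
      using b setsH U(2) finL by (intro emeasure_Diff[symmetric]) auto
    also have "\<dots> < ennreal d" by fact
    finally have "prob (L - ?L) < prob L"
      using b sets_eq_borel by (intro d) auto
    moreover have "prob L \<le> prob (L - ?L) + prob ?L"
    proof -
      have "prob L \<le> prob ((L - ?L) \<union> ?L)"
        using b sets_eq_borel by (intro finite_measure_mono) auto
      also have "\<dots> \<le> prob (L - ?L) + prob ?L"
        using b sets_eq_borel by (intro measure_subadditive) (auto simp: emeasure_eq_measure)
      finally show ?thesis .
    qed
    ultimately show ?thesis by simp
  qed
  show "\<exists>T. open T \<and> g0 \<in> T \<and> T \<subseteq> {g. prob {h. g + h \<in> P} > 0}"
  proof (intro exI conjI)
    \<comment> \<open>For \<open>u = - g + g0\<close> one has \<open>g + (u + l) = g0 + l\<close>,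
      so translating \<open>L\<close> by \<open>u\<close> moves it into the set belonging to
      \<open>g\<close>.\<close>
    show "open ((\<lambda>g. - g + g0) -` V)"
      by (intro open_vimage V) (intro continuous_intros)
    show "g0 \<in> (\<lambda>g. - g + g0) -` V"
      using V by simp
    show "(\<lambda>g. - g + g0) -` V \<subseteq> {g. prob {h. g + h \<in> P} > 0}"
    proof safe
      fix g assume g: "- g + g0 \<in> V"
      have "(\<lambda>l. - g + g0 + l) ` L \<subseteq> {h. g + h \<in> P}"
        using L(2) by (auto simp: add.assoc)
      then have "prob ((\<lambda>l. - g + g0 + l) ` L) \<le> prob {h. g + h \<in> P}"
        by (intro finite_measure_mono meas)
      with overlap[OF g] show "prob {h. g + h \<in> P} > 0" by simp
    qed
  qed
qed

text \<open>A form of admissibility that only asks for the points of the support: by second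
  countability the null basic open sets have a null union, so \<open>S\<close> has full
  measure.\<close>

lemma subsemigroup_eq_UNIV:
  assumes S: "closed S" "\<And>g h. g \<in> S \<Longrightarrow> h \<in> S \<Longrightarrow> g + h \<in> S"
    and supp: "\<And>h. (\<And>U. open U \<Longrightarrow> h \<in> U \<Longrightarrow> prob U > 0) \<Longrightarrow> h \<in> S"
  shows "S = UNIV"
proof -
  obtain B :: "'g set set" where B: "countable B" "topological_basis B"
    using ex_countable_basis by blast
  have space: "space \<theta> = UNIV"
    using sets_eq_imp_space_eq[OF sets_eq_borel] by simp
  have "AE h in \<theta>. \<forall>b\<in>B. prob b = 0 \<longrightarrow> h \<notin> b"
  proof (subst AE_ball_countable[OF B(1)], intro ballI)
    fix b assume "b \<in> B"
    then have "b \<in> events"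
      using topological_basis_open[OF B(2)] sets_eq_borel by auto
    then show "AE h in \<theta>. prob b = 0 \<longrightarrow> h \<notin> b"
      by (cases "prob b = 0")
        (auto intro!: AE_not_in simp: null_sets_def emeasure_eq_measure)
  qed
  moreover have "h \<in> S" if h: "\<forall>b\<in>B. prob b = 0 \<longrightarrow> h \<notin> b" for h
  proof (rule supp)
    fix U assume U: "open U" "h \<in> U"
    then obtain b where b: "b \<in> B" "h \<in> b" "b \<subseteq> U"
      using topological_basisE[OF B(2)] by metis
    then have "prob b > 0"
      using h by (auto simp: zero_less_measure_iff)
    also have "prob b \<le> prob U"
      using b U(1) sets_eq_borel by (intro finite_measure_mono) auto
    finally show "prob U > 0" .
  qed
  ultimately have "AE h in \<theta>. h \<in> S" by auto
  then have "emeasure \<theta> S = 1"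
    using S(1) sets_eq_borel by (intro emeasure_eq_1_AE) auto
  then show ?thesis
    using not_supported_on_subsemigroup[OF S(1)] S(2) by simp
qed

text \<open>
  The hypothesis makes \<open>P\<close> open, so the complement of \<open>P\<close> is closed, and the right translations
  preserving it form a closed subsemigroup containing the support of \<open>\<theta>\<close>.
\<close>

lemma recurrent_set_eq_empty:
  assumes P: "P \<in> sets borel" "0 \<notin> P" "\<And>g. g \<in> P \<longleftrightarrow> prob {h. g + h \<in> P} > 0"
  shows "P = {}"
proof -
  have "open P"
    using open_translates_positive[OF P(1)] by (simp flip: P(3))
  have op: "open ((\<lambda>s. n + s) -` P)" for n
    by (intro open_vimage \<open>open P\<close> continuous_intros)
  define S where "S = (\<Inter>n\<in>- P. - ((\<lambda>s. n + s) -` P))"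
  have "S = UNIV"
  proof (rule subsemigroup_eq_UNIV)
    show "closed S"
      unfolding S_def using op by (intro closed_INT) auto
    show "g + h \<in> S" if "g \<in> S" "h \<in> S" for g h
      using that by (auto simp: S_def simp flip: add.assoc)
    fix h assume h: "\<And>U. open U \<Longrightarrow> h \<in> U \<Longrightarrow> prob U > 0"
    \<comment> \<open>Otherwise the steps leading from \<open>n\<close> into \<open>P\<close> form
      an open set around \<open>h\<close>. Since \<open>h\<close> is in the support, this set has
      positive mass, which puts \<open>n\<close> itself into \<open>P\<close>.\<close>
    have "n + h \<notin> P" if "n \<notin> P" for n
    proof
      assume "n + h \<in> P"
      then have "prob ((\<lambda>s. n + s) -` P) > 0"
        by (intro h[OF op]) simp
      then have "n \<in> P"
        by (subst P(3)) (simp add: vimage_def)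
      with that show False by simp
    qed
    then show "h \<in> S" by (auto simp: S_def)
  qed
  then have "0 + s \<notin> P" for s
    using P(2) unfolding S_def by blast
  then show ?thesis by auto
qed

text \<open>The maximum principle in quantitative form: near maximisers of \<open>F\<close> replace
  a point at which the supremum is attained.\<close>

lemma harmonic_vanishing_at_infinity:
  fixes F :: "'g \<Rightarrow> real"
  assumes F: "F \<in> borel_measurable borel" "\<And>g. 0 \<le> F g" "\<And>g. F g \<le> b"
    and harmonic: "\<And>g. F g = (\<integral>h. F (g + h) \<partial>\<theta>)"
    and vanish: "\<And>e. e > 0 \<Longrightarrow> \<exists>K. compact K \<and> {g. F g \<ge> e} \<subseteq> K"
    and pos: "F g0 > 0"
  shows "compact (UNIV :: 'g set)"
proof -
  define M where "M = (SUP g. F g)"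
  have bdd: "bdd_above (range F)"
    using F(3) by (rule bdd_aboveI2)
  have M: "F g \<le> M" for g
    unfolding M_def by (intro cSUP_upper bdd) auto
  have M0: "M > 0"
    using M[of g0] pos by simp
  have near: "\<exists>g. M - F g < d" if "d > 0" for d
    using that less_cSUP_iff[of UNIV F "M - d"] bdd unfolding M_def[symmetric]
    by (auto simp: algebra_simps)
  have [measurable]: "(\<lambda>h. F (g + h)) \<in> borel_measurable \<theta>" for g
    using measurable_compose[OF translation_measurable F(1)] .
  have int: "integrable \<theta> (\<lambda>h. F (g + h))" for g
    using F(2,3) by (intro integrable_const_bound[of _ b]) (auto simp: abs_le_iff intro: order_trans)
  \<comment> \<open>Membership is tested on neighbourhoods of \<open>s\<close>, which makes
    \<open>S\<close> closed. That \<open>d\<close> does not depend on \<open>g\<close> allows two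
    steps to be chained.\<close>
  define S where "S = {s. \<forall>U. open U \<longrightarrow> s \<in> U \<longrightarrow>
    (\<forall>e>0. \<exists>d>0. \<forall>g. M - F g < d \<longrightarrow> (\<exists>u\<in>U. M - F (g + u) < e))}"
  have SD: "\<exists>d>0. \<forall>g. M - F g < d \<longrightarrow> (\<exists>u\<in>U. M - F (g + u) < e)"
    if "s \<in> S" "open U" "s \<in> U" "e > 0" for s U e
    using that by (simp add: S_def)
  have "S = UNIV"
  proof (rule subsemigroup_eq_UNIV)
    have "open (- S)"
    proof (subst open_subopen, rule ballI)
      fix s assume "s \<in> - S"
      then obtain U where U: "open U" "s \<in> U"
        "\<not> (\<forall>e>0. \<exists>d>0. \<forall>g. M - F g < d \<longrightarrow> (\<exists>u\<in>U. M - F (g + u) < e))"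
        unfolding S_def by blast
      then have "U \<subseteq> - S"
        unfolding S_def by blast
      with U show "\<exists>T. open T \<and> s \<in> T \<and> T \<subseteq> - S" by blast
    qed
    then show "closed S" by (simp add: closed_def)
  next
    fix s t assume s: "s \<in> S" and t: "t \<in> S"
    show "s + t \<in> S"
      unfolding S_def
    proof (intro CollectI allI impI)
      fix U :: "'g set" and e :: real
      assume U: "open U" "s + t \<in> U" and e: "e > 0"
      have "open ((\<lambda>(v, w). v + w) -` U)"
        by (intro open_vimage U) (auto simp: split_beta intro!: continuous_intros)
      then obtain V W where VW: "open V" "s \<in> V" "open W" "t \<in> W"
        "V \<times> W \<subseteq> (\<lambda>(v, w). v + w) -` U"
        using U(2) by (auto elim!: open_prod_elim[of _ "(s, t)"])
      \<comment> \<open>Tolerances are chosen backwards: the second step \<open>t\<close> determines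
        the accuracy \<open>d1\<close> required of the first step \<open>s\<close>.\<close>
      obtain d1 where d1: "d1 > 0"
        "\<And>g. M - F g < d1 \<Longrightarrow> \<exists>w\<in>W. M - F (g + w) < e"
        using SD[OF t VW(3,4) e] by auto
      obtain d2 where d2: "d2 > 0"
        "\<And>g. M - F g < d2 \<Longrightarrow> \<exists>v\<in>V. M - F (g + v) < d1"
        using SD[OF s VW(1,2) d1(1)] by auto
      have "\<exists>u\<in>U. M - F (g + u) < e" if g: "M - F g < d2" for g
      proof -
        obtain v where v: "v \<in> V" "M - F (g + v) < d1"
          using d2(2)[OF g] by blast
        obtain w where w: "w \<in> W" "M - F (g + v + w) < e"
          using d1(2)[OF v(2)] by blast
        have "(v, w) \<in> (\<lambda>(v, w). v + w) -` U"
          using v w VW(5) by blast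
        then have "v + w \<in> U" by simp
        with w(2) show ?thesis by (auto simp: add.assoc)
      qed
      with d2(1) show "\<exists>d>0. \<forall>g. M - F g < d \<longrightarrow> (\<exists>u\<in>U. M - F (g + u) < e)" by blast
    qed
  next
    fix s assume s: "\<And>U. open U \<Longrightarrow> s \<in> U \<Longrightarrow> prob U > 0"
    show "s \<in> S"
      unfolding S_def
    proof (intro CollectI allI impI)
      fix U :: "'g set" and e :: real
      assume U: "open U" "s \<in> U" and e: "e > 0"
      have [measurable]: "U \<in> events" using U sets_eq_borel by auto
      \<comment> \<open>The threshold comes from Markov's inequality: if every step in
        \<open>U\<close> ended at least \<open>e\<close> below \<open>M\<close>, the average
        deficit, which is \<open>M - F g\<close> by harmonicity, would be at least
        \<open>e * prob U\<close>.\<close>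
      have "\<exists>u\<in>U. M - F (g + u) < e" if g: "M - F g < e * prob U" for g
      proof (rule ccontr)
        assume neg: "\<not> ?thesis"
        have "e * prob U = (\<integral>h. e * indicator U h \<partial>\<theta>)" by simp
        also have "\<dots> \<le> (\<integral>h. M - F (g + h) \<partial>\<theta>)"
        proof (intro integral_mono)
          show "integrable \<theta> (\<lambda>h. e * indicator U h)"
            by (intro integrable_mult_right integrable_real_indicator) (auto simp: emeasure_eq_measure)
          show "integrable \<theta> (\<lambda>h. M - F (g + h))"
            using int by simp
          show "e * indicator U h \<le> M - F (g + h)" for h
            using neg M[of "g + h"] by (auto simp: indicator_def not_less)
        qed
        also have "\<dots> = M - F g"
          using int by (simp add: prob_space flip: harmonic)
        finally show False using g by simp
      qed
      moreover have "e * prob U > 0" using s U e by simp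
      ultimately show "\<exists>d>0. \<forall>g. M - F g < d \<longrightarrow> (\<exists>u\<in>U. M - F (g + u) < e)" by blast
    qed
  qed
  moreover obtain K where K: "compact K" "{g. F g \<ge> M / 2} \<subseteq> K"
    using vanish[of "M / 2"] M0 by auto
  \<comment> \<open>\<open>C\<close> contains every step between two points of \<open>K\<close>. A
    step of \<open>S\<close> outside \<open>C\<close> could be approximated by one that leads from a
    value above \<open>M / 2\<close> to another such value, hence from \<open>K\<close> to
    \<open>K\<close>, while staying outside \<open>C\<close>.\<close>
  define C where "C = (\<lambda>(a, b). - a + b) ` (K \<times> K)"
  have C: "compact C"
    unfolding C_def using K
    by (intro compact_continuous_image compact_Times) (auto simp: split_beta intro!: continuous_intros)
  moreover have "S \<subseteq> C"
  proof
    fix s assume s: "s \<in> S"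
    show "s \<in> C"
    proof (rule ccontr)
      assume "s \<notin> C"
      then have "open (- C)" "s \<in> - C"
        using compact_imp_closed[OF C] by auto
      then obtain d where d: "d > 0" "\<And>g. M - F g < d \<Longrightarrow> \<exists>u\<in>- C. M - F (g + u) < M / 2"
        using SD[OF s, of "- C" "M / 2"] M0 by auto
      obtain g where g: "M - F g < min d (M / 2)"
        using near[of "min d (M / 2)"] d M0 by auto
      then obtain u where u: "u \<notin> C" "M - F (g + u) < M / 2"
        using d(2)[of g] by auto
      have "g \<in> K" "g + u \<in> K"
        using K(2) g u(2) by auto
      then have "- g + (g + u) \<in> C"
        unfolding C_def by (intro image_eqI[of _ _ "(g, g + u)"]) auto
      with u(1) show False by (simp flip: add.assoc)
    qed
  qed
  ultimately show ?thesis by (simp add: top.extremum_unique)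
qed

end

section \<open>Preimages of Borel sets under the action\<close>

context stationary_space
begin

text \<open>For \<open>A\<close> inside the space this is the image of \<open>A\<close> under
  \<open>act (- g)\<close>, so its measure is \<open>translate act g \<mu> A\<close>. The preimage
  form gives measurability directly.\<close>

definition preimage :: "'x set \<Rightarrow> 'g \<Rightarrow> 'x set" where
  "preimage A g = {x \<in> space \<mu>. act g x \<in> A}"

lemma act_space: "x \<in> space \<mu> \<Longrightarrow> act g x \<in> space \<mu>"
  using measurable_space[OF measurable_act, of "(g, x)"] by (simp add: space_pair_measure)

lemma act_image_eq:
  assumes "A \<subseteq> space \<mu>"
  shows "act g ` A = preimage A (- g)"
proof (intro set_eqI iffI)
  fix x assume "x \<in> act g ` A"
  then obtain y where y: "y \<in> A" "x = act g y" by blast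
  then have "y \<in> space \<mu>" using assms by blast
  with y show "x \<in> preimage A (- g)"
    using act_add[of y "- g" g] by (simp add: preimage_def act_space act_zero)
next
  fix x assume x: "x \<in> preimage A (- g)"
  then have "x = act g (act (- g) x)"
    using act_add[of x g "- g"] by (simp add: preimage_def act_zero)
  with x show "x \<in> act g ` A"
    by (auto simp: preimage_def)
qed

lemma act_measurable [measurable]: "act g \<in> \<mu> \<rightarrow>\<^sub>M \<mu>"
  using measurable_compose[OF measurable_Pair1'[of g borel \<mu>] measurable_act] by simp

lemma preimage_sets [measurable, simp]: "A \<in> sets \<mu> \<Longrightarrow> preimage A g \<in> sets \<mu>"
  using measurable_sets[OF act_measurable, of A g]
  by (simp add: preimage_def vimage_def Collect_conj_eq Int_commute)

lemma preimage_0: "A \<subseteq> space \<mu> \<Longrightarrow> preimage A 0 = A"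
  by (auto simp: preimage_def act_zero)

text \<open>Through this identity, stationarity applied to \<open>preimage A g\<close> becomes an
  average over the right translates \<open>g + h\<close>.\<close>

lemma preimage_add: "A \<subseteq> space \<mu> \<Longrightarrow> preimage A (g + h) = preimage (preimage A g) h"
  by (auto simp: preimage_def act_add act_space)

lemma measure_preimage_measurable [measurable]:
  assumes "A \<in> sets \<mu>"
  shows "(\<lambda>g. measure \<mu> (preimage A g)) \<in> borel_measurable borel"
proof -
  define Q where "Q = (\<lambda>(g, x). act g x) -` A \<inter> space (borel \<Otimes>\<^sub>M \<mu>)"
  have "Q \<in> sets (borel \<Otimes>\<^sub>M \<mu>)"
    unfolding Q_def by (rule measurable_sets[OF measurable_act assms])
  then have "(\<lambda>g. emeasure \<mu> (Pair g -` Q)) \<in> borel_measurable borel"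
    by (rule measurable_emeasure_Pair)
  moreover have "Pair g -` Q = preimage A g" for g
    by (auto simp: Q_def preimage_def space_pair_measure)
  ultimately show ?thesis
    unfolding measure_def by (intro borel_measurable_enn2real) simp
qed

end

section \<open>Harmonicity, quasi-invariance and vanishing at infinity\<close>

locale measured_stationary_space = stationary_space \<theta> act \<mu> + G: measured_group \<theta>
  for \<theta> :: "'g::lcsc_group measure" and act :: "'g \<Rightarrow> 'x \<Rightarrow> 'x" and \<mu> :: "'x measure"
begin

lemma measure_preimage_translate_measurable:
  assumes "A \<in> sets \<mu>"
  shows "(\<lambda>h. prob (preimage A (g + h))) \<in> borel_measurable \<theta>"
  using measurable_compose[OF G.translation_measurable measure_preimage_measurable[OF assms]] .

lemma measure_preimage_translate_integrable:
  assumes "A \<in> sets \<mu>"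
  shows "integrable \<theta> (\<lambda>h. prob (preimage A (g + h)))"
  using measure_preimage_translate_measurable[OF assms]
  by (intro G.integrable_const_bound[of _ 1]) auto

lemma measure_preimage_harmonic:
  assumes A: "A \<in> sets \<mu>"
  shows "prob (preimage A g) = (\<integral>h. prob (preimage A (g + h)) \<partial>\<theta>)"
proof -
  have AS: "A \<subseteq> space \<mu>" using A by (rule sets.sets_into_space)
  have "ennreal (prob (preimage A g)) = action_convolution act \<theta> \<mu> (preimage A g)"
    using stationary[of "preimage A g"] A by (simp add: emeasure_eq_measure)
  also have "\<dots> = (\<integral>\<^sup>+h. emeasure \<mu> (preimage A (g + h)) \<partial>\<theta>)"
    unfolding action_convolution_def translate_def
    using AS by (simp add: act_image_eq preimage_add sets.sets_into_space A)
  also have "\<dots> = ennreal (\<integral>h. prob (preimage A (g + h)) \<partial>\<theta>)"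
    unfolding emeasure_eq_measure
    by (intro nn_integral_eq_integral measure_preimage_translate_integrable A) simp
  finally show ?thesis
    by (simp add: integral_nonneg_AE)
qed

text \<open>Quasi-invariance of \<open>\<mu>\<close>. A nonnegative function has integral zero iff
  it vanishes almost everywhere, so by harmonicity the set \<open>P\<close> of bad \<open>g\<close>
  contains \<open>g\<close> iff the walk steps from \<open>g\<close> into \<open>P\<close> with
  positive probability; it misses \<open>0\<close> because \<open>A\<close> is null.\<close>

lemma null_sets_preimage:
  assumes A: "A \<in> null_sets \<mu>"
  shows "preimage A g \<in> null_sets \<mu>"
proof -
  have sets: "A \<in> sets \<mu>" using A by blast
  define P where "P = {g. prob (preimage A g) > 0}"
  have "P = {}"
  proof (rule G.recurrent_set_eq_empty)
    have "{g \<in> space borel. prob (preimage A g) > 0} \<in> sets borel"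
      using measure_preimage_measurable[OF sets] by measurable
    then show P: "P \<in> sets borel" by (simp add: P_def)
    show "0 \<notin> P"
      using measure_eq_0_null_sets[OF A] by (simp add: P_def preimage_0 sets.sets_into_space[OF sets])
    show "g \<in> P \<longleftrightarrow> G.prob {h. g + h \<in> P} > 0" for g
    proof -
      have space: "space \<theta> = UNIV"
        using sets_eq_imp_space_eq[OF G.sets_eq_borel] by simp
      have meas: "{h \<in> space \<theta>. g + h \<in> P} \<in> G.events"
        using measurable_sets[OF G.translation_measurable P, of g] by (simp add: space vimage_def)
      have "g \<notin> P \<longleftrightarrow> (\<integral>h. prob (preimage A (g + h)) \<partial>\<theta>) = 0"
        unfolding P_def using measure_preimage_harmonic[OF sets, of g]
        by (simp add: zero_less_measure_iff)
      also have "\<dots> \<longleftrightarrow> (AE h in \<theta>. prob (preimage A (g + h)) = 0)"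
        by (intro integral_nonneg_eq_0_iff_AE measure_preimage_translate_integrable sets) simp
      also have "\<dots> \<longleftrightarrow> (AE h in \<theta>. \<not> g + h \<in> P)"
        by (simp add: P_def zero_less_measure_iff)
      also have "\<dots> \<longleftrightarrow> G.prob {h \<in> space \<theta>. g + h \<in> P} = 0"
        using G.prob_eq_0[OF meas] by simp
      finally show ?thesis
        by (auto simp: space zero_less_measure_iff)
    qed
  qed
  then have "prob (preimage A g) = 0"
    by (auto simp: P_def zero_less_measure_iff)
  then show ?thesis
    using sets by (auto simp: null_sets_def emeasure_eq_measure)
qed

text \<open>The set \<open>preimage A (h - g) \<inter> A\<close> equals \<open>act (g - h)\<close>
  applied to \<open>A\<close>, intersected with \<open>A\<close>, and is null by hypothesis. Pulling
  it back by \<open>g\<close> yields the intersection of the two preimages, which is null by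
  quasi-invariance.\<close>

lemma AE_not_both_returning:
  assumes A: "A \<in> sets \<mu>" and gh: "g - h \<notin> return_set act \<mu> A"
  shows "AE x in \<mu>. x \<notin> preimage A g \<or> x \<notin> preimage A h"
proof -
  have AS: "A \<subseteq> space \<mu>" using A by (rule sets.sets_into_space)
  have "emeasure \<mu> (preimage A (h - g) \<inter> A) = 0"
    using gh act_image_eq[OF AS, of "g - h"] by (auto simp: return_set_def)
  then have "preimage A (h - g) \<inter> A \<in> null_sets \<mu>"
    using A by auto
  then have "preimage (preimage A (h - g) \<inter> A) g \<in> null_sets \<mu>"
    by (rule null_sets_preimage)
  moreover have "act (h - g) (act g x) = act h x" if "x \<in> space \<mu>" for x
    using act_add[OF that, of "h - g" g] by simp
  then have "preimage (preimage A (h - g) \<inter> A) g = preimage A g \<inter> preimage A h"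
    by (auto simp: preimage_def act_space)
  ultimately have "AE x in \<mu>. x \<notin> preimage A g \<inter> preimage A h"
    by (intro AE_not_in) simp
  then show ?thesis by simp
qed

text \<open>
  The elements \<open>g\<close> whose preimages of \<open>A\<close> are large admit only boundedly many almost disjoint
  preimages; a maximal such family shows that they lie in finitely many translates of the closure
  of the return set.
\<close>

lemma measure_preimage_vanishing:
  assumes A: "A \<in> sets \<mu>" and K: "compact (closure (return_set act \<mu> A))" and e: "e > 0"
  shows "\<exists>C. compact C \<and> {g. prob (preimage A g) \<ge> e} \<subseteq> C"
proof -
  define E where "E = {g. prob (preimage A g) \<ge> e}"
  define R where "R g h \<longleftrightarrow> (AE x in \<mu>. x \<notin> preimage A g \<or> x \<notin> preimage A h)" for g h
  have R_sym: "R h g" if "R g h" for g h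
    using that by (auto simp: R_def)
  define D where "D F \<longleftrightarrow> finite F \<and> F \<subseteq> E \<and> pairwise R F" for F
  \<comment> \<open>Almost disjoint sets of mass at least \<open>e\<close> in a probability space
    number at most \<open>1 / e\<close>.\<close>
  have card: "card F \<le> nat \<lfloor>1 / e\<rfloor>" if "D F" for F
  proof -
    have F: "finite F" "F \<subseteq> E"
      "pairwise (\<lambda>g h. AE x in \<mu>. x \<notin> preimage A g \<or> x \<notin> preimage A h) F"
      using that by (auto simp: D_def R_def[abs_def])
    have "real (card F) * e = (\<Sum>g\<in>F. e)" by simp
    also have "\<dots> \<le> (\<Sum>g\<in>F. prob (preimage A g))"
      using F(2) by (intro sum_mono) (auto simp: E_def)
    also have "\<dots> = prob (\<Union>g\<in>F. preimage A g)"
      using F A by (intro measure_UNION_AE[symmetric]) (auto simp: fmeasurable_eq_sets)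
    also have "\<dots> \<le> 1" by simp
    finally have "real (card F) \<le> 1 / e"
      using e by (simp add: field_simps)
    then show ?thesis by (simp add: le_nat_floor)
  qed
  have "D {}" by (simp add: D_def)
  then obtain F where F: "D F" and max: "\<And>F'. D F' \<Longrightarrow> card F' \<le> card F"
    using ex_has_greatest_nat[of D "{}" card "Suc (nat \<lfloor>1 / e\<rfloor>)"] card by (metis le_imp_less_Suc)
  have returns: "\<exists>f\<in>F. g - f \<in> return_set act \<mu> A" if g: "g \<in> E" for g
  proof (rule ccontr)
    assume neg: "\<not> ?thesis"
    then have AE: "R g f" if "f \<in> F" for f
      unfolding R_def using that AE_not_both_returning[OF A] by blast
    \<comment> \<open>If \<open>g\<close> were in \<open>F\<close>, its preimage would be almost
      disjoint from itself, hence null, against mass at least \<open>e\<close>. So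
      \<open>insert g F\<close> is strictly larger and contradicts maximality.\<close>
    have "g \<notin> F"
    proof
      assume "g \<in> F"
      then have "AE x in \<mu>. x \<notin> preimage A g" using AE[of g] by (simp add: R_def)
      then have "prob (preimage A g) = 0"
        using A prob_eq_0[of "preimage A g"] by simp
      then show False using g e by (simp add: E_def)
    qed
    moreover have "D (insert g F)"
      using F g AE R_sym[OF AE] by (auto simp: D_def pairwise_insert)
    ultimately have "card F + 1 \<le> card F"
      using max[of "insert g F"] F by (auto simp: D_def)
    then show False by simp
  qed
  have "E \<subseteq> (\<Union>f\<in>F. (\<lambda>k. k + f) ` closure (return_set act \<mu> A))"
  proof
    fix g assume "g \<in> E"
    then obtain f where f: "f \<in> F" "g - f \<in> return_set act \<mu> A"
      using returns by blast
    then have "g \<in> (\<lambda>k. k + f) ` closure (return_set act \<mu> A)"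
      by (intro image_eqI[of _ _ "g - f"] subsetD[OF closure_subset]) simp_all
    with f(1) show "g \<in> (\<Union>f\<in>F. (\<lambda>k. k + f) ` closure (return_set act \<mu> A))"
      by blast
  qed
  moreover have "compact (\<Union>f\<in>F. (\<lambda>k. k + f) ` closure (return_set act \<mu> A))"
    using F K by (intro compact_UN compact_continuous_image continuous_intros) (auto simp: D_def)
  ultimately show ?thesis
    unfolding E_def by blast
qed

end

section \<open>Conservativity of the action\<close>

theorem theorem1p1:
  fixes \<theta> :: "'g::lcsc_group measure"
    and act :: "'g \<Rightarrow> 'x \<Rightarrow> 'x"
    and \<mu> :: "'x measure"
  assumes "measured_group \<theta>"
    and "\<not> compact (UNIV :: 'g set)"
    and "stationary_space \<theta> act \<mu>"
  shows "conservative act \<mu>"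
proof -
  interpret measured_stationary_space \<theta> act \<mu>
    using assms by (simp add: measured_stationary_space_def)
  show ?thesis
    unfolding conservative_def
  proof (intro ballI impI notI)
    fix A assume A: "A \<in> sets \<mu>" "emeasure \<mu> A > 0" and K: "compact (closure (return_set act \<mu> A))"
    have "compact (UNIV :: 'g set)"
    proof (rule G.harmonic_vanishing_at_infinity[where F = "\<lambda>g. prob (preimage A g)"])
      \<comment> \<open>The identity supplies the positive value, since
        \<open>preimage A 0 = A\<close>.\<close>
      show "prob (preimage A 0) > 0"
        using A by (simp add: preimage_0 sets.sets_into_space emeasure_eq_measure)
      show "\<exists>K. compact K \<and> {g. prob (preimage A g) \<ge> e} \<subseteq> K" if "e > 0" for e
        using measure_preimage_vanishing[OF A(1) K that] .
      show "(\<lambda>g. prob (preimage A g)) \<in> borel_measurable borel"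
        by (rule measure_preimage_measurable[OF A(1)])
      show "prob (preimage A g) = (\<integral>h. prob (preimage A (g + h)) \<partial>\<theta>)" for g
        by (rule measure_preimage_harmonic[OF A(1)])
      show "0 \<le> prob (preimage A g)" "prob (preimage A g) \<le> 1" for g
        by simp_all
    qed
    with assms(2) show False by simp
  qed
qed

end
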